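(* Let $\mathcal{S}=\mathcal{S}(\omega)$ be the EigenWave operator (defined in the context) with target frequency $\omega>0$, number of periods $N_p\in\{1,2,3,\dots\}$ and final time $T_f = N_p\,\frac{2\pi}{\omega}$. Then $\mathcal{S}$ has the same eigenfunctions $\phi_j(\mathbf{x})$, $j=0,1,2,\ldots$, as the operator $\mathcal{L}$ with boundary conditions $\mathcal{B}$ (where $\mathcal{L}\phi_j=-\lambda_j^2\phi_j$ in $\Omega$, $\mathcal{B}\phi_j=0$ on $\partial\Omega$, $\lambda_j\ge 0$), but with different eigenvalues, namely $$\mathcal{S}\,\phi_j = \beta_j\,\phi_j,\qquad \beta_j := \beta(\lambda_j;\omega)\in\left[-\tfrac12,\,1\right],\qquad j=0,1,2,\ldots,$$ where $\beta(\lambda;\omega)$ is the WaveHoltz filter function $$\beta(\lambda;\omega) := \frac{2}{T_f}\int_0^{T_f}\left(\cos(\omega t)-\frac14\right)\cos(\lambda t)\,dt .$$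
   Context: Let $\Omega\subset\mathbb{R}^{d}$ be a bounded domain with boundary $\partial\Omega$, let $c>0$ be a constant, and let $\mathcal{L}=c^2\Delta$ where $\Delta$ is the Laplacian. Let $\mathcal{B}$ be a boundary operator representing homogeneous Dirichlet, Neumann or Robin boundary conditions. The eigenvalue problem is $$\mathcal{L}\phi=-\lambda^2\phi \ \text{ in } \Omega,\qquad \mathcal{B}\phi=0\ \text{ on }\partial\Omega .$$ Standing assumptions: the eigenvalues $-\lambda^2$ are real and non-positive (for Robin conditions this restricts the admissible coefficients), so that one takes $\lambda\ge 0$; and the problem has a complete set of linearly independent eigenfunctions $\phi_j(\mathbf{x})$, $j=0,1,2,\ldots$, with corresponding $\lambda_j\ge 0$ (not necessarily distinct), in terms of which functions are expanded. Definition of the EigenWave operator $\mathcal{S}$: fix a target frequency $\omega>0$ and a positive integer $N_p$, and set $T_f=N_p\,(2\pi/\omega)$. Given a function $v(\mathbf{x})$ on $\Omega$, let $w(\mathbf{x},t)=w(\mathbf{x},t;v)$ be the solution of the initial-boundary-value problem $$\partial_t^2 w=\mathcal{L}w \ \ (\mathbf{x}\in\Omega,\ 0<t<T_f),\qquad \mathcal{B}w=0\ \ (\mathbf{x}\in\partial\Omega,\ 0<t<T_f),$$ $$w(\mathbf{x},0)=v(\mathbf{x}),\qquad \partial_t w(\mathbf{x},0)=0\ \ (\mathbf{x}\in\Omega).$$ Then $\mathcal{S}$ is the linear operator defined by $$(\mathcal{S}v)(\mathbf{x}) = \frac{2}{T_f}\int_0^{T_f}\left(\cos(\omega t)-\frac14\right)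 w(\mathbf{x},t;v)\,dt .$$ The phrase "the same eigenfunctions but with different eigenvalues" means that each $\phi_j$ is an eigenfunction of $\mathcal{S}$, with the eigenvalue $-\lambda_j^2$ of $\mathcal{L}$ replaced by $\beta_j$; it does not assert that $\beta_j$ and $-\lambda_j^2$ can never coincide numerically. *)

theory Defs
  imports "HOL-Analysis.Analysis"
begin

subsection \<open>Differential operators\<close>

definition partial_deriv :: "'a::euclidean_space \<Rightarrow> ('a \<Rightarrow> real) \<Rightarrow> 'a \<Rightarrow> real" where
  "partial_deriv b u x = frechet_derivative u (at x) b"

definition grad :: "('a::euclidean_space \<Rightarrow> real) \<Rightarrow> 'a \<Rightarrow> 'a" where
  "grad u x = (\<Sum>b\<in>Basis. partial_deriv b u x *\<^sub>R b)"

definition laplacian :: "('a::euclidean_space \<Rightarrow> real) \<Rightarrow> 'a \<Rightarrow> real" where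
  "laplacian u x = (\<Sum>b\<in>Basis. partial_deriv b (partial_deriv b u) x)"

text \<open>The next two notions are meant for open sets.\<close>

definition C1_on :: "'a::euclidean_space set \<Rightarrow> ('a \<Rightarrow> real) \<Rightarrow> bool" where
  "C1_on S u \<longleftrightarrow>
     (\<forall>x\<in>S. u differentiable (at x)) \<and> (\<forall>b\<in>Basis. continuous_on S (partial_deriv b u))"

definition C2_on :: "'a::euclidean_space set \<Rightarrow> ('a \<Rightarrow> real) \<Rightarrow> bool" where
  "C2_on S u \<longleftrightarrow> C1_on S u \<and> (\<forall>b\<in>Basis. C1_on S (partial_deriv b u))"

subsection \<open>Domains and boundary conditions\<close>

definition bounded_domain :: "'a::euclidean_space set \<Rightarrow> bool" where
  "bounded_domain \<Omega> \<longleftrightarrow> open \<Omega> \<and> connected \<Omega> \<and> \<Omega> \<noteq> {} \<and> bounded \<Omega>"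

text \<open>
  \<open>\<nu>\<close> is the outward unit normal at \<open>p\<close>: near \<open>p\<close>, every closed cone with apex \<open>p\<close> around \<open>- \<nu>\<close>
  of opening angle less than 180 degrees lies in \<open>\<Omega>\<close> (up to \<open>p\<close>), and every such cone around \<open>\<nu>\<close>
  lies outside. There is at most one such \<open>\<nu>\<close>; it exists wherever the boundary is \<open>C\<^sup>1\<close> and
  \<open>\<Omega>\<close> lies on one side, and does not exist at corners and edges.
\<close>

definition outward_normal :: "'a::euclidean_space set \<Rightarrow> 'a \<Rightarrow> 'a \<Rightarrow> bool" where
  "outward_normal \<Omega> p \<nu> \<longleftrightarrow> p \<in> frontier \<Omega> \<and> norm \<nu> = 1 \<and>
     (\<forall>e>0. \<exists>r>0. \<forall>x\<in>ball p r - {p}.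
        ((x - p) \<bullet> \<nu> \<le> - e * norm (x - p) \<longrightarrow> x \<in> \<Omega>) \<and>
        ((x - p) \<bullet> \<nu> \<ge> e * norm (x - p) \<longrightarrow> x \<notin> \<Omega>))"

text \<open>\<open>\<Omega>\<close> together with those boundary points at which the outward normal exists.\<close>

definition regular_closure :: "'a::euclidean_space set \<Rightarrow> 'a set" where
  "regular_closure \<Omega> = \<Omega> \<union> {p. \<exists>\<nu>. outward_normal \<Omega> p \<nu>}"

text \<open>
  The classical one-sided normal derivative: for a function \<open>u\<close> on the closure, only values at
  points \<open>p + s \<nu>\<close> with \<open>s \<le> 0\<close> enter.
\<close>

definition has_normal_derivative :: "('a::euclidean_space \<Rightarrow> real) \<Rightarrow> 'a \<Rightarrow> 'a \<Rightarrow> real \<Rightarrow> bool" where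
  "has_normal_derivative u p \<nu> D \<longleftrightarrow>
     ((\<lambda>s. u (p + s *\<^sub>R \<nu>)) has_real_derivative D) (at 0 within {..0})"

text \<open>The Robin condition with coefficient \<open>\<kappa>\<close> is \<open>\<partial>u/\<partial>\<nu> + \<kappa> u = 0\<close>.\<close>

datatype 'a bc = Dirichlet | Neumann | Robin "'a \<Rightarrow> real"

fun satisfies_bc :: "'a::euclidean_space bc \<Rightarrow> 'a set \<Rightarrow> ('a \<Rightarrow> real) \<Rightarrow> bool" where
  "satisfies_bc Dirichlet \<Omega> u \<longleftrightarrow> (\<forall>p\<in>frontier \<Omega>. u p = 0)"
| "satisfies_bc Neumann \<Omega> u \<longleftrightarrow>
     (\<forall>p\<in>frontier \<Omega>. \<forall>\<nu>. outward_normal \<Omega> p \<nu> \<longrightarrow> has_normal_derivative u p \<nu> 0)"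
| "satisfies_bc (Robin \<kappa>) \<Omega> u \<longleftrightarrow>
     (\<forall>p\<in>frontier \<Omega>. \<forall>\<nu>. outward_normal \<Omega> p \<nu> \<longrightarrow>
        (\<exists>D. has_normal_derivative u p \<nu> D \<and> D + \<kappa> p * u p = 0))"

definition extends_continuously ::
    "'a::topological_space set \<Rightarrow> 'a set \<Rightarrow> ('a \<Rightarrow> 'b::topological_space) \<Rightarrow> bool" where
  "extends_continuously S S' f \<longleftrightarrow> (\<exists>g. continuous_on S' g \<and> (\<forall>x\<in>S. g x = f x))"

subsection \<open>The eigenvalue problem\<close>

text \<open>
  Classical eigenfunctions of \<open>c\<^sup>2 \<Delta>\<close> with eigenvalue \<open>\<mu>\<close>: twice continuously differentiable inside,
  continuous up to the boundary and, if the boundary condition involves a derivative,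
  continuously differentiable up to the regular part of the boundary.
\<close>

definition eigenfunction ::
    "real \<Rightarrow> 'a::euclidean_space set \<Rightarrow> 'a bc \<Rightarrow> real \<Rightarrow> ('a \<Rightarrow> real) \<Rightarrow> bool" where
  "eigenfunction c \<Omega> B \<mu> \<phi> \<longleftrightarrow>
     C2_on \<Omega> \<phi> \<and> continuous_on (closure \<Omega>) \<phi> \<and>
     (B \<noteq> Dirichlet \<longrightarrow> extends_continuously \<Omega> (regular_closure \<Omega>) (grad \<phi>)) \<and>
     (\<exists>x\<in>\<Omega>. \<phi> x \<noteq> 0) \<and>
     (\<forall>x\<in>\<Omega>. c\<^sup>2 * laplacian \<phi> x = \<mu> * \<phi> x) \<and>
     satisfies_bc B \<Omega> \<phi>"

definition linearly_independent_on :: "'a set \<Rightarrow> (nat \<Rightarrow> 'a \<Rightarrow> real) \<Rightarrow> bool" where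
  "linearly_independent_on \<Omega> \<phi> \<longleftrightarrow>
     (\<forall>n a. (\<forall>x\<in>\<Omega>. (\<Sum>j<n. a j * \<phi> j x) = 0) \<longrightarrow> (\<forall>j<n. a j = 0))"

text \<open>Completeness: the linear span is dense in the space of square-integrable functions.\<close>

definition complete_on :: "'a::euclidean_space set \<Rightarrow> (nat \<Rightarrow> 'a \<Rightarrow> real) \<Rightarrow> bool" where
  "complete_on \<Omega> \<phi> \<longleftrightarrow>
     (\<forall>f. f \<in> borel_measurable (lebesgue_on \<Omega>) \<and> integrable (lebesgue_on \<Omega>) (\<lambda>x. (f x)\<^sup>2) \<longrightarrow>
        (\<forall>e>0. \<exists>n a. (LINT x|lebesgue_on \<Omega>. (f x - (\<Sum>j<n. a j * \<phi> j x))\<^sup>2) < e))"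

subsection \<open>The wave equation and the EigenWave operator\<close>

text \<open>
  Classical solutions of the initial-boundary-value problem on \<open>\<Omega> \<times> [0,T]\<close> with data \<open>(v, 0)\<close>.
  The regularity up to the boundary matches that of the eigenfunctions, and the time derivative
  is continuous up to (and one-sided at) the initial time.
\<close>

definition wave_solution ::
    "real \<Rightarrow> 'a::euclidean_space set \<Rightarrow> 'a bc \<Rightarrow> real \<Rightarrow> ('a \<Rightarrow> real) \<Rightarrow> ('a \<Rightarrow> real \<Rightarrow> real) \<Rightarrow> bool" where
  "wave_solution c \<Omega> B T v w \<longleftrightarrow>
     continuous_on (closure \<Omega> \<times> {0..T}) (\<lambda>(x, t). w x t) \<and>
     C2_on (\<Omega> \<times> {0<..<T}) (\<lambda>(x, t). w x t) \<and>
     continuous_on (\<Omega> \<times> {0..<T}) (\<lambda>(x, t). vector_derivative (w x) (at t within {0..T})) \<and>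
     (B \<noteq> Dirichlet \<longrightarrow>
        extends_continuously (\<Omega> \<times> {0<..<T}) (regular_closure \<Omega> \<times> {0<..<T})
          (\<lambda>(x, t). grad (\<lambda>y. w y t) x)) \<and>
     (\<forall>x\<in>\<Omega>. \<forall>t\<in>{0<..<T}. deriv (deriv (w x)) t = c\<^sup>2 * laplacian (\<lambda>y. w y t) x) \<and>
     (\<forall>t\<in>{0<..<T}. satisfies_bc B \<Omega> (\<lambda>y. w y t)) \<and>
     (\<forall>x\<in>\<Omega>. w x 0 = v x) \<and>
     (\<forall>x\<in>\<Omega>. (w x has_real_derivative 0) (at 0 within {0..T}))"

text \<open>Only this makes it meaningful to speak of \<^emph>\<open>the\<close> solution with initial data \<open>v\<close>.\<close>

definition wave_solutions_unique :: "real \<Rightarrow> 'a::euclidean_space set \<Rightarrow> 'a bc \<Rightarrow> real \<Rightarrow> bool" where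
  "wave_solutions_unique c \<Omega> B T \<longleftrightarrow>
     (\<forall>v w w'. wave_solution c \<Omega> B T v w \<and> wave_solution c \<Omega> B T v w' \<longrightarrow>
        (\<forall>x\<in>\<Omega>. \<forall>t\<in>{0<..<T}. w x t = w' x t))"

definition final_time :: "real \<Rightarrow> nat \<Rightarrow> real" where
  "final_time \<omega> Np = real Np * (2 * pi / \<omega>)"

text \<open>
  Solutions are determined at most on the closure of \<open>\<Omega>\<close> and on \<open>[0,T]\<close>, whereas \<open>w\<close> is a total
  function; hence \<open>SOME\<close>, not \<open>THE\<close>. The value of \<open>eigenwave\<close> at points of \<open>\<Omega>\<close> does not
  depend on the choice if solutions are unique in the above sense.
\<close>

definition eigenwave ::
    "real \<Rightarrow> 'a::euclidean_space set \<Rightarrow> 'a bc \<Rightarrow> real \<Rightarrow> nat \<Rightarrow> ('a \<Rightarrow> real) \<Rightarrow> 'a \<Rightarrow> real" where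
  "eigenwave c \<Omega> B \<omega> Np v x =
     (let T = final_time \<omega> Np; w = (SOME w. wave_solution c \<Omega> B T v w)
      in 2 / T * integral {0..T} (\<lambda>t. (cos (\<omega> * t) - 1 / 4) * w x t))"

definition waveholtz_filter :: "real \<Rightarrow> nat \<Rightarrow> real \<Rightarrow> real" where
  "waveholtz_filter \<omega> Np lam =
     (let T = final_time \<omega> Np
      in 2 / T * integral {0..T} (\<lambda>t. (cos (\<omega> * t) - 1 / 4) * cos (lam * t)))"

end

theory Submission
  imports Defs
begin

text \<open>
  The separated function \<open>\<phi>(x) cos (\<lambda> t)\<close> solves the wave equation with data \<open>(\<phi>, 0)\<close>, so by
  uniqueness \<open>\<S>\<phi> = \<beta>(\<lambda>) \<phi>\<close>. For the bounds on \<open>\<beta>\<close>, put \<open>a = \<omega> T = 2 \<pi> N\<close>, \<open>s = \<lambda> T\<close> and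
  \<open>d = s - a\<close>. Since \<open>sin (s \<plusminus> a) = sin s\<close>,
  \<open>\<beta> = sinc (s - a) + sinc (s + a) - sinc s / 2 = sinc d * (1 + d\<^sup>2 / (2 s (s + a)))\<close>.
  If \<open>s < \<pi>\<close>, a quartic upper bound for \<open>sinc s\<close> gives \<open>-1/2 \<le> \<beta> \<le> 0\<close>; if \<open>s \<ge> \<pi>\<close> and \<open>\<bar>d\<bar> \<le> \<pi>\<close>,
  the same bound for \<open>sinc d\<close> gives \<open>0 \<le> \<beta> \<le> 1\<close>; otherwise \<open>\<bar>\<beta>\<bar> \<le> 3 / (2 \<pi>) < 1/2\<close>.
\<close>

subsection \<open>The filter function\<close>

text \<open>The unnormalised cardinal sine. The value 1 at 0 is the continuous extension, so the
  closed form of the filter also covers the resonance \<open>lam = \<omega>\<close> and the static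
  mode \<open>lam = 0\<close>.\<close>

definition sinc :: "real \<Rightarrow> real" where
  "sinc x = (if x = 0 then 1 else sin x / x)"

lemma integral_cos_scaled:
  fixes T k :: real
  assumes "T \<ge> 0"
  shows "((\<lambda>t. cos (k * t)) has_integral T * sinc (k * T)) {0..T}"
proof (cases "k = 0")
  case True
  then show ?thesis
    using has_integral_const_real[of "1::real" 0 T] assms by (simp add: sinc_def)
next
  case False
  have "((\<lambda>t. cos (k * t)) has_integral sin (k * T) / k - sin (k * 0) / k) {0..T}"
    using assms False
    by (intro fundamental_theorem_of_calculus)
       (auto intro!: derivative_eq_intros simp: has_real_derivative_iff_has_vector_derivative[symmetric])
  then show ?thesis
    using False by (cases "T = 0") (auto simp: sinc_def)
qed

text \<open>By product-to-sum, \<open>cos (\<omega> * t) * cos (lam * t)\<close> is half the sum of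
  the cosines with frequencies \<open>lam - \<omega>\<close> and \<open>lam + \<omega>\<close>,
  which leaves three cosine integrals. In the scaled variable \<open>s\<close>, the target frequency
  survives only as the phase \<open>a\<close>.\<close>

lemma waveholtz_filter_eq_sinc:
  fixes lam :: real
  assumes "\<omega> > 0" "Np \<ge> 1"
  defines "a \<equiv> 2 * pi * real Np"
  defines "s \<equiv> lam * final_time \<omega> Np"
  shows "waveholtz_filter \<omega> Np lam = sinc (s - a) + sinc (s + a) - sinc s / 2"
proof -
  define T where "T = final_time \<omega> Np"
  have T: "T > 0" and a: "a = \<omega> * T"
    using assms by (auto simp: T_def final_time_def a_def)
  have "((\<lambda>t. (cos ((lam - \<omega>) * t) + cos ((lam + \<omega>) * t)) / 2 - cos (lam * t) / 4) has_integral
      (T * sinc ((lam - \<omega>) * T) + T * sinc ((lam + \<omega>) * T)) / 2 - (T * sinc (lam * T)) / 4) {0..T}"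
    using T by (intro has_integral_diff has_integral_divide has_integral_add integral_cos_scaled) auto
  moreover have "(cos ((lam - \<omega>) * t) + cos ((lam + \<omega>) * t)) / 2 - cos (lam * t) / 4
      = (cos (\<omega> * t) - 1 / 4) * cos (lam * t)" for t
    by (simp add: cos_add cos_diff algebra_simps)
  ultimately have "integral {0..T} (\<lambda>t. (cos (\<omega> * t) - 1 / 4) * cos (lam * t))
      = (T * sinc ((lam - \<omega>) * T) + T * sinc ((lam + \<omega>) * T)) / 2 - (T * sinc (lam * T)) / 4"
    by (simp add: integral_unique)
  then show ?thesis
    using T by (simp add: waveholtz_filter_def Let_def flip: T_def)
      (simp add: a s_def flip: T_def, simp add: field_simps)
qed

section \<open>Elementary estimates for sinc and pi\<close>

lemma sinc_upper:
  assumes "x \<ge> 0"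
  shows "sinc x \<le> 1 - x\<^sup>2 / 6 + x ^ 4 / 120"
proof (cases "x = 0")
  case False
  \<comment> \<open>Even sine coefficients vanish, so five terms give only a cubic, while the
    remainder is already of order 5.\<close>
  have "{..<5} = {0, 1, 2, 3, 4 :: nat}" by auto
  then have "(\<Sum>m<5. sin_coeff m * x ^ m) = x - x ^ 3 / 6"
    by (simp add: sin_coeff_def fact_numeral)
  then have "\<bar>sin x - (x - x ^ 3 / 6)\<bar> \<le> x ^ 5 / 120"
    using Maclaurin_sin_bound[of x 5] assms by (simp add: fact_numeral)
  then have "sin x \<le> x - x ^ 3 / 6 + x ^ 5 / 120"
    by linarith
  also have "\<dots> = x * (1 - x\<^sup>2 / 6 + x ^ 4 / 120)"
    by (simp add: eval_nat_numeral algebra_simps)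
  finally have "sin x \<le> x * (1 - x\<^sup>2 / 6 + x ^ 4 / 120)" .
  then show ?thesis
    using False assms by (simp add: sinc_def divide_le_eq mult.commute)
qed (simp add: sinc_def)

lemma sinc_minus [simp]: "sinc (- x) = sinc x"
  by (simp add: sinc_def)

lemma sinc_abs: "sinc \<bar>x\<bar> = sinc x"
  by (simp add: abs_if)

lemma sinc_nonneg:
  assumes "\<bar>x\<bar> \<le> pi"
  shows "sinc x \<ge> 0"
proof -
  have "sinc \<bar>x\<bar> \<ge> 0"
    using assms by (auto simp: sinc_def intro!: divide_nonneg_nonneg sin_ge_zero)
  then show ?thesis by (simp add: sinc_abs)
qed

lemma abs_sinc_le:
  assumes "pi \<le> \<bar>x\<bar>"
  shows "\<bar>sinc x\<bar> \<le> 1 / \<bar>x\<bar>"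
proof -
  have "x \<noteq> 0" using assms pi_gt_zero by linarith
  then show ?thesis by (simp add: sinc_def divide_right_mono)
qed

text \<open>The upper bound keeps the squared arguments \<open>q\<close> below 10 in both polynomial
  estimates; the lower one gives \<open>54 \<le> p\<close>.\<close>

lemma pi_square_bounds: "9 < pi\<^sup>2" "pi\<^sup>2 < 10"
proof -
  have "3 < pi" "pi < 3.15"
    using pi_approx by (auto)
  then show "9 < pi\<^sup>2" "pi\<^sup>2 < 10"
    using power_strict_mono[of 3 pi 2] power_strict_mono[of pi "3.15" 2]
    by (auto simp: power2_eq_square)
qed

text \<open>Both bounds are sharp: -1/2 is the value at \<open>s = 0\<close>, and 1 is the value at
  \<open>s = a\<close>. Near these points a polynomial bound for \<open>sinc\<close> is needed; away
  from them \<open>\<bar>sin d\<bar> \<le> 1\<close> suffices.\<close>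

lemma sinc_combination_bounds:
  fixes s :: real and N :: nat
  assumes s: "s \<ge> 0" and N: "N \<ge> 1"
  defines "a \<equiv> 2 * pi * real N"
  shows "sinc (s - a) + sinc (s + a) - sinc s / 2 \<in> {- 1 / 2..1}"
proof -
  define \<beta> where "\<beta> = sinc (s - a) + sinc (s + a) - sinc s / 2"
  have "2 * pi * 1 \<le> a"
    unfolding a_def using N by (intro mult_left_mono) auto
  then have a: "a \<ge> 2 * pi" by simp
  have sin_a: "sin a = 0" "cos a = 1"
    using sin_npi2[of "2 * N"] cos_2npi[of N] by (auto simp: a_def mult_ac)
  have sin_s: "sin (s - a) = sin s" "sin (s + a) = sin s"
    by (simp_all add: sin_diff sin_add sin_a)
  have pi3: "pi > 3" using pi_approx by simp
  show ?thesis
  proof (cases "s < pi")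
    case True
    define q where "q = s\<^sup>2"
    have q: "0 \<le> q" "q < 10"
      using True s pi_square_bounds(2) power_strict_mono[of s pi 2] by (auto simp: q_def)
    have sa: "s < a" "s\<^sup>2 < a\<^sup>2"
      using True a pi3 s power_strict_mono[of s a 2] by auto
    have a2: "a\<^sup>2 \<ge> 36"
      using power_mono[of 6 a 2] a pi3 by simp
    \<comment> \<open>All three numerators are \<open>sin s\<close>, and
      \<open>1 / (s - a) + 1 / (s + a) - 1 / (2 * s)\<close> has numerator
      \<open>a\<^sup>2 + 3 * s\<^sup>2\<close> over
      \<open>2 * s * (s\<^sup>2 - a\<^sup>2)\<close>.\<close>
    have \<beta>: "\<beta> = - (sinc s * (a\<^sup>2 + 3 * q) / (2 * (a\<^sup>2 - q)))"
    proof (cases "s = 0")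
      case True
      then show ?thesis
        using sa sin_s sin_a by (auto simp: \<beta>_def q_def sinc_def)
    next
      case False
      have ne: "s - a \<noteq> 0" "s + a \<noteq> 0" "a * a - s * s \<noteq> 0"
        using sa s by (auto simp: power2_eq_square)
      then show ?thesis
        unfolding \<beta>_def q_def using False sin_s
        by (simp add: sinc_def divide_simps power2_eq_square) (simp add: algebra_simps)
    qed
    have nn: "sinc s \<ge> 0" by (rule sinc_nonneg) (use s True in auto)
    \<comment> \<open>Clearing the positive denominator turns \<open>\<beta> \<ge> - 1 / 2\<close>
      into \<open>sinc s * (a\<^sup>2 + 3 * q) \<le> a\<^sup>2 - q\<close>.\<close>
    have "sinc s * (a\<^sup>2 + 3 * q) \<le> (1 - q / 6 + q\<^sup>2 / 120) * (a\<^sup>2 + 3 * q)"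
      using sinc_upper[OF s] q
      by (intro mult_right_mono) (auto simp: q_def simp flip: power_mult)
    also have "\<dots> \<le> a\<^sup>2 - q"
    proof -
      \<comment> \<open>Since \<open>1 - q / 6 + q\<^sup>2 / 120 = 1 - q * (20 - q) / 120\<close>,
        the subtracted term must be at least \<open>4 * q\<close>, whence 480 = 4 * 120.\<close>
      have "480 \<le> (20 - q) * (36 + 3 * q)"
      proof -
        have "0 \<le> q * (10 - q)" using q by simp
        then show ?thesis using q by (simp add: algebra_simps)
      qed
      also have "\<dots> \<le> (20 - q) * (a\<^sup>2 + 3 * q)"
        using q a2 by (intro mult_left_mono) auto
      finally have "q * 480 \<le> q * ((20 - q) * (a\<^sup>2 + 3 * q))"
        using q by (intro mult_left_mono) auto
      moreover have "(1 - q / 6 + q\<^sup>2 / 120) * (a\<^sup>2 + 3 * q)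
          = a\<^sup>2 + 3 * q - q * ((20 - q) * (a\<^sup>2 + 3 * q)) / 120"
        by (simp add: field_simps power2_eq_square)
      ultimately show ?thesis by linarith
    qed
    finally have "\<beta> \<ge> - 1 / 2"
      using sa by (simp add: \<beta> q_def field_simps)
    moreover have "\<beta> \<le> 0"
      using nn sa q by (auto simp: \<beta> q_def)
    ultimately show ?thesis by (auto simp flip: \<beta>_def)
  next
    case False
    define d where "d = s - a"
    define p where "p = 2 * s * (s + a)"
    have sa: "s \<ge> pi" "s > 0" "a > 0" "s + a \<ge> 3 * pi" "s + a > 0"
      using False a pi3 by auto
    have p: "p > 0" using sa by (auto simp: p_def)
    \<comment> \<open>With the common sine written as \<open>sin d\<close>, this is
      \<open>1 / (s + a) - 1 / (2 * s) = d / p\<close>.\<close>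
    have \<beta>: "\<beta> = sinc d * (1 + d\<^sup>2 / p)"
    proof (cases "d = 0")
      case True
      then show ?thesis
        using sin_s sa sin_a by (auto simp: \<beta>_def d_def sinc_def)
    next
      case False
      have ne: "s - a \<noteq> 0" "s + a \<noteq> 0" "s \<noteq> 0"
        using sa False by (auto simp: d_def)
      then show ?thesis
        unfolding \<beta>_def d_def p_def using sin_s
        by (simp add: sinc_def divide_simps power2_eq_square) (simp add: algebra_simps)
    qed
    show ?thesis
    proof (cases "\<bar>d\<bar> \<le> pi")
      case True
      define q where "q = d\<^sup>2"
      have q: "0 \<le> q" "q < 10"
        using True pi_square_bounds(2) power_mono[of "\<bar>d\<bar>" pi 2] by (auto simp: q_def)
      \<comment> \<open>From \<open>s \<ge> pi\<close> and \<open>s + a \<ge> 3 * pi\<close>,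
        \<open>p\<close> is at least \<open>6 * pi\<^sup>2\<close>, which exceeds 54.\<close>
      have "2 * (pi * (3 * pi)) \<le> 2 * (s * (s + a))"
        using sa pi3 by (intro mult_left_mono mult_mono) auto
      then have "54 \<le> p"
        using pi_square_bounds by (simp add: p_def power2_eq_square)
      then have "q / p \<le> q / 54"
        using q by (intro divide_left_mono) auto
      have nn: "sinc d \<ge> 0" using True by (rule sinc_nonneg)
      have "sinc d \<le> 1 - q / 6 + q\<^sup>2 / 120"
        using sinc_upper[of "\<bar>d\<bar>"] by (simp add: q_def sinc_abs flip: power_mult)
      \<comment> \<open>As \<open>q < 10\<close>, the quartic term is at most \<open>q / 12\<close>,
        half of the quadratic one.\<close>
      also have "\<dots> \<le> 1 - q / 12"
      proof -
        have "0 \<le> q * (10 - q)" using q by simp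
        then show ?thesis by (simp add: algebra_simps power2_eq_square)
      qed
      finally have "\<beta> \<le> (1 - q / 12) * (1 + q / 54)"
        unfolding \<beta> using \<open>q / p \<le> q / 54\<close> nn q p by (intro mult_mono) (auto simp: q_def)
      \<comment> \<open>The loss 1/12 outweighs the gain 1/54.\<close>
      also have "\<dots> \<le> 1"
        using q by (simp add: algebra_simps)
      finally have "\<beta> \<le> 1" .
      moreover have "\<beta> \<ge> 0" using nn p by (auto simp: \<beta>)
      ultimately show ?thesis by (auto simp flip: \<beta>_def)
    next
      case False
      then have d: "\<bar>d\<bar> \<ge> pi" "\<bar>d\<bar> > 0" using pi3 by auto
      have "\<bar>\<beta>\<bar> = \<bar>sinc d\<bar> * (1 + d\<^sup>2 / p)"
        using p by (simp add: \<beta> abs_mult)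
      also have "\<dots> \<le> (1 / \<bar>d\<bar>) * (1 + d\<^sup>2 / p)"
        using p abs_sinc_le[OF d(1)] by (intro mult_right_mono) auto
      also have "\<dots> = 1 / \<bar>d\<bar> + \<bar>d\<bar> / p"
        using d p by (simp add: field_simps power2_eq_square)
      \<comment> \<open>Here \<open>\<bar>s - a\<bar> \<le> s + a\<close>, chosen so that the factor
        \<open>s + a\<close> cancels against \<open>p\<close>.\<close>
      also have "\<dots> \<le> 1 / pi + (s + a) / p"
        using d p sa by (intro add_mono divide_right_mono divide_left_mono) (auto simp: d_def)
      also have "(s + a) / p = 1 / (2 * s)"
        using sa by (simp add: p_def)
      also have "\<dots> \<le> 1 / (2 * pi)"
        using sa by (intro divide_left_mono) auto
      also have "1 / pi + 1 / (2 * pi) \<le> 1 / 2"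
        using pi3 by (simp add: field_simps)
      finally show ?thesis by (auto simp flip: \<beta>_def)
    qed
  qed
qed

lemma waveholtz_filter_bounds:
  assumes "\<omega> > 0" "Np \<ge> 1" "lam \<ge> 0"
  shows "waveholtz_filter \<omega> Np lam \<in> {- 1 / 2..1}"
  using assms sinc_combination_bounds[of "lam * final_time \<omega> Np" Np]
  by (simp add: waveholtz_filter_eq_sinc final_time_def)

subsection \<open>Separated solutions of the wave equation\<close>

lemma partial_deriv_eqI:
  assumes "(u has_derivative u') (at x)"
  shows "partial_deriv b u x = u' b"
  using frechet_derivative_at[OF assms] by (simp add: partial_deriv_def)

lemma has_derivative_cong_open:
  assumes "open S" "x \<in> S" "\<And>y. y \<in> S \<Longrightarrow> u y = v y"
  shows "(u has_derivative D) (at x) \<longleftrightarrow> (v has_derivative D) (at x)"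
  using has_derivative_transform_within_open[of u D x UNIV S v]
    has_derivative_transform_within_open[of v D x UNIV S u] assms by auto

text \<open>Holds even where no derivative exists: \<open>frechet_derivative\<close> is a choice
  among the derivatives at \<open>x\<close>, and \<open>u\<close> and \<open>v\<close> have the same
  ones.\<close>

lemma partial_deriv_cong_open:
  assumes "open S" "x \<in> S" "\<And>y. y \<in> S \<Longrightarrow> u y = v y"
  shows "partial_deriv b u x = partial_deriv b v x"
  using has_derivative_cong_open[OF assms] by (simp add: partial_deriv_def frechet_derivative_def)

lemma C1_on_cong_open:
  assumes "open S" "\<And>y. y \<in> S \<Longrightarrow> u y = v y"
  shows "C1_on S u \<longleftrightarrow> C1_on S v"
proof -
  have "u differentiable (at x) \<longleftrightarrow> v differentiable (at x)" if "x \<in> S" for x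
    using has_derivative_cong_open[OF assms(1) that assms(2)] by (simp add: differentiable_def)
  moreover have "continuous_on S (partial_deriv b u) \<longleftrightarrow> continuous_on S (partial_deriv b v)" for b
    using partial_deriv_cong_open[OF assms(1) _ assms(2)] by (intro continuous_on_cong) auto
  ultimately show ?thesis by (auto simp: C1_on_def)
qed

lemma C1_on_imp_continuous_on: "C1_on S u \<Longrightarrow> continuous_on S u"
  by (auto simp: C1_on_def differentiable_imp_continuous_within continuous_at_imp_continuous_on)

lemma partial_deriv_mult_const:
  assumes "u differentiable (at x)"
  shows "partial_deriv b (\<lambda>y. u y * k) x = partial_deriv b u x * k"
proof -
  obtain D where D: "(u has_derivative D) (at x)"
    using assms by (auto simp: differentiable_def)
  have "((\<lambda>y. u y * k) has_derivative (\<lambda>h. D h * k)) (at x)"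
    by (auto intro!: derivative_eq_intros D)
  then show ?thesis
    using D by (simp add: partial_deriv_eqI)
qed

lemma grad_mult_const:
  assumes "u differentiable (at x)"
  shows "grad (\<lambda>y. u y * k) x = k *\<^sub>R grad u x"
  using assms by (simp add: grad_def partial_deriv_mult_const scaleR_sum_right)
    (simp add: mult.commute)

text \<open>The scaling rule for first partials is known only on \<open>S\<close>; openness lets it
  be differentiated once more.\<close>

lemma laplacian_mult_const:
  assumes "open S" "C2_on S u" "x \<in> S"
  shows "laplacian (\<lambda>y. u y * k) x = laplacian u x * k"
proof -
  have "partial_deriv b (partial_deriv b (\<lambda>y. u y * k)) x
      = partial_deriv b (\<lambda>y. partial_deriv b u y * k) x" for b
    using assms by (intro partial_deriv_cong_open[OF assms(1,3)] partial_deriv_mult_const)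
      (auto simp: C2_on_def C1_on_def)
  also have "\<dots> b = partial_deriv b (partial_deriv b u) x * k" if "b \<in> Basis" for b
    using assms that by (intro partial_deriv_mult_const) (auto simp: C2_on_def C1_on_def)
  finally show ?thesis
    by (simp add: laplacian_def sum_distrib_right)
qed

section \<open>Regularity of separated functions in space and time\<close>

lemma has_derivative_separated:
  fixes u :: "'a::euclidean_space \<Rightarrow> real"
  assumes "u differentiable (at x)" "(g has_real_derivative g') (at t)"
  shows "((\<lambda>(x, t). u x * g t) has_derivative
      (\<lambda>h. frechet_derivative u (at x) (fst h) * g t + u x * (g' * snd h))) (at (x, t))"
proof -
  have u: "(u has_derivative frechet_derivative u (at x)) (at x)"
    using assms(1) by (simp add: frechet_derivative_works)
  have g: "(g has_derivative (*) g') (at t)"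
    using assms(2) by (simp add: has_field_derivative_def)
  have "((\<lambda>z. u (fst z)) has_derivative (\<lambda>h. frechet_derivative u (at x) (fst h))) (at (x, t))"
    by (rule has_derivative_compose[OF has_derivative_fst[OF has_derivative_ident]]) (simp add: u)
  moreover have "((\<lambda>z. g (snd z)) has_derivative (\<lambda>h. g' * snd h)) (at (x, t))"
    by (rule has_derivative_compose[OF has_derivative_snd[OF has_derivative_ident]]) (simp add: g)
  ultimately show ?thesis
    using has_derivative_mult by (fastforce simp: case_prod_beta' add.commute)
qed

lemma partial_deriv_separated:
  fixes u :: "'a::euclidean_space \<Rightarrow> real"
  assumes "u differentiable (at x)" "(g has_real_derivative g') (at t)"
  shows "partial_deriv (b, 0) (\<lambda>(x, t). u x * g t) (x, t) = partial_deriv b u x * g t"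
    and "partial_deriv (0, 1) (\<lambda>(x, t). u x * g t) (x, t) = u x * g'"
proof -
  \<comment> \<open>The time direction \<open>(0, 1)\<close> has spatial component 0, so the spatial
    term must vanish there.\<close>
  have "frechet_derivative u (at x) 0 = 0"
    using assms(1) by (simp add: frechet_derivative_works linear_0 has_derivative_linear)
  then show "partial_deriv (b, 0) (\<lambda>(x, t). u x * g t) (x, t) = partial_deriv b u x * g t"
    and "partial_deriv (0, 1) (\<lambda>(x, t). u x * g t) (x, t) = u x * g'"
    using partial_deriv_eqI[OF has_derivative_separated[OF assms]]
    by (auto simp: partial_deriv_def[of b])
qed

lemma continuous_on_separated:
  fixes f :: "'a::topological_space \<Rightarrow> real" and g :: "'b::topological_space \<Rightarrow> real"
  assumes "continuous_on S f" "continuous_on I g"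
  shows "continuous_on (S \<times> I) (\<lambda>(x, t). f x * g t)"
  unfolding case_prod_beta'
  by (intro continuous_intros continuous_on_compose2[OF assms(1)] continuous_on_compose2[OF assms(2)])
    auto

lemma C1_on_separated:
  fixes u :: "'a::euclidean_space \<Rightarrow> real" and I :: "real set"
  assumes u: "C1_on S u" and g: "\<And>t. (g has_real_derivative g' t) (at t)"
    and g': "continuous_on I g'"
  shows "C1_on (S \<times> I) (\<lambda>(x, t). u x * g t)"
proof -
  have du: "u differentiable (at x)" if "x \<in> S" for x
    using u that by (simp add: C1_on_def)
  have "continuous_on I g"
    using g by (meson DERIV_isCont continuous_at_imp_continuous_on)
  have "(\<lambda>(x, t). u x * g t) differentiable (at z)" if "z \<in> S \<times> I" for z
    using has_derivative_separated[OF du g] that by (cases z) (auto simp: differentiable_def)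
  moreover have "continuous_on (S \<times> I) (partial_deriv (b, 0) (\<lambda>(x, t). u x * g t))"
    if "b \<in> Basis" for b
  proof -
    have "continuous_on (S \<times> I) (\<lambda>(x, t). partial_deriv b u x * g t)"
      using u that \<open>continuous_on I g\<close> by (intro continuous_on_separated) (auto simp: C1_on_def)
    then show ?thesis
      by (rule continuous_on_eq) (auto simp: partial_deriv_separated(1)[OF du g])
  qed
  moreover have "continuous_on (S \<times> I) (partial_deriv (0, 1) (\<lambda>(x, t). u x * g t))"
  proof -
    have "continuous_on (S \<times> I) (\<lambda>(x, t). u x * g' t)"
      using u g' by (intro continuous_on_separated) (auto intro: C1_on_imp_continuous_on)
    then show ?thesis
      by (rule continuous_on_eq) (auto simp: partial_deriv_separated(2)[OF du g])
  qed
  ultimately show ?thesis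
    by (auto simp: C1_on_def Basis_prod_def)
qed

text \<open>First partials of a separated function are again separated, so the \<open>C1_on\<close>
  result applies to each. These formulas hold only on \<open>S \<times> I\<close>, so the transfer
  goes through \<open>C1_on_cong_open\<close>.\<close>

lemma C2_on_separated:
  fixes u :: "'a::euclidean_space \<Rightarrow> real" and I :: "real set"
  assumes S: "open S" and I: "open I" and u: "C2_on S u"
    and g: "\<And>t. (g has_real_derivative g' t) (at t)"
    and g': "\<And>t. (g' has_real_derivative g'' t) (at t)"
    and g'': "continuous_on I g''"
  shows "C2_on (S \<times> I) (\<lambda>(x, t). u x * g t)"
proof -
  have SI: "open (S \<times> I)" using S I by (rule open_Times)
  have C1: "C1_on S u" "\<And>b. b \<in> Basis \<Longrightarrow> C1_on S (partial_deriv b u)"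
    using u by (auto simp: C2_on_def)
  have du: "u differentiable (at x)" if "x \<in> S" for x
    using C1(1) that by (simp add: C1_on_def)
  have cont: "continuous_on I g'"
    using g' by (meson DERIV_isCont continuous_at_imp_continuous_on)
  have "C1_on (S \<times> I) (partial_deriv (b, 0) (\<lambda>(x, t). u x * g t))" if "b \<in> Basis" for b
    using C1_on_separated[OF C1(2)[OF that] g cont]
    by (subst C1_on_cong_open[OF SI]) (auto simp: partial_deriv_separated(1)[OF du g])
  moreover have "C1_on (S \<times> I) (partial_deriv (0, 1) (\<lambda>(x, t). u x * g t))"
    using C1_on_separated[OF C1(1) g' g'']
    by (subst C1_on_cong_open[OF SI]) (auto simp: partial_deriv_separated(2)[OF du g])
  ultimately show ?thesis
    using C1_on_separated[OF C1(1) g cont] by (auto simp: C2_on_def Basis_prod_def)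
qed

section \<open>Homogeneous boundary conditions and the separated solution\<close>

lemma has_normal_derivative_mult_const:
  assumes "has_normal_derivative u p \<nu> D"
  shows "has_normal_derivative (\<lambda>y. u y * k) p \<nu> (D * k)"
  using assms unfolding has_normal_derivative_def by (auto intro!: derivative_eq_intros)

lemma satisfies_bc_mult_const:
  assumes "satisfies_bc B \<Omega> u"
  shows "satisfies_bc B \<Omega> (\<lambda>y. u y * k)"
proof (cases B)
  case Neumann
  then show ?thesis
    using assms has_normal_derivative_mult_const[of u _ _ 0 k] by auto
next
  case (Robin \<kappa>)
  have "\<exists>D'. has_normal_derivative (\<lambda>y. u y * k) p \<nu> D' \<and> D' + \<kappa> p * (u p * k) = 0"
    if "has_normal_derivative u p \<nu> D" "D + \<kappa> p * u p = 0" for p \<nu> D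
  proof (intro exI conjI)
    show "has_normal_derivative (\<lambda>y. u y * k) p \<nu> (D * k)"
      by (rule has_normal_derivative_mult_const) fact
    have "D * k + \<kappa> p * (u p * k) = (D + \<kappa> p * u p) * k"
      by (simp add: algebra_simps)
    then show "D * k + \<kappa> p * (u p * k) = 0"
      using that by simp
  qed
  then show ?thesis
    using assms Robin by simp metis
qed (use assms in simp)

text \<open>Two time derivatives of the cosine and \<open>c\<^sup>2\<close> times the Laplacian of
  \<open>\<phi>\<close> both produce the factor \<open>- (l\<^sup>2)\<close>. At each fixed time the
  cosine is a constant, which homogeneous boundary conditions tolerate.\<close>

lemma wave_solution_eigenfunction:
  fixes \<phi> :: "'a::euclidean_space \<Rightarrow> real"
  assumes \<Omega>: "open \<Omega>" and T: "T > 0" and \<phi>: "eigenfunction c \<Omega> B (- (l\<^sup>2)) \<phi>"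
  shows "wave_solution c \<Omega> B T \<phi> (\<lambda>x t. \<phi> x * cos (l * t))"
proof -
  have C2: "C2_on \<Omega> \<phi>" and cont: "continuous_on (closure \<Omega>) \<phi>"
    and grad_ext: "B \<noteq> Dirichlet \<Longrightarrow> extends_continuously \<Omega> (regular_closure \<Omega>) (grad \<phi>)"
    and eq: "\<And>x. x \<in> \<Omega> \<Longrightarrow> c\<^sup>2 * laplacian \<phi> x = - (l\<^sup>2) * \<phi> x"
    and bc: "satisfies_bc B \<Omega> \<phi>"
    using \<phi> by (auto simp: eigenfunction_def)
  have diff: "\<phi> differentiable (at x)" if "x \<in> \<Omega>" for x
    using C2 that by (simp add: C2_on_def C1_on_def)
  \<comment> \<open>The set \<open>A\<close> is arbitrary, to serve two-sided derivatives as well as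
    those within \<open>{0..T}\<close>.\<close>
  have D1: "((\<lambda>t. cos (l * t)) has_real_derivative - l * sin (l * t)) (at t within A)" for t A
    by (auto intro!: derivative_eq_intros)
  have D2: "((\<lambda>t. - l * sin (l * t)) has_real_derivative - (l\<^sup>2) * cos (l * t)) (at t)" for t
    by (auto intro!: derivative_eq_intros simp: power2_eq_square)
  have Dw: "((\<lambda>t. \<phi> x * cos (l * t)) has_real_derivative \<phi> x * (- l * sin (l * t))) (at t within A)"
    for x t A
    by (rule DERIV_cmult) (rule D1)
  have Dw2: "((\<lambda>t. \<phi> x * (- l * sin (l * t))) has_real_derivative \<phi> x * (- (l\<^sup>2) * cos (l * t))) (at t)"
    for x t
    by (rule DERIV_cmult) (rule D2)
  show ?thesis
    unfolding wave_solution_def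
  proof (intro conjI ballI impI)
    show "continuous_on (closure \<Omega> \<times> {0..T}) (\<lambda>(x, t). \<phi> x * cos (l * t))"
      by (intro continuous_on_separated cont continuous_intros)
    show "C2_on (\<Omega> \<times> {0<..<T}) (\<lambda>(x, t). \<phi> x * cos (l * t))"
      by (intro C2_on_separated[OF \<Omega> _ C2 D1 D2] continuous_intros open_greaterThanLessThan)
    have "continuous_on (\<Omega> \<times> {0..<T}) (\<lambda>(x, t). \<phi> x * (- l * sin (l * t)))"
      using cont closure_subset
      by (intro continuous_on_separated continuous_intros) (auto intro: continuous_on_subset)
    moreover have "vector_derivative (\<lambda>t. \<phi> x * cos (l * t)) (at t within {0..T})
        = \<phi> x * (- l * sin (l * t))" if "t \<in> {0..<T}" for x t
      using Dw[of x t "{0..T}"] that T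
      by (intro vector_derivative_within_closed_interval)
         (auto simp: has_real_derivative_iff_has_vector_derivative)
    ultimately show "continuous_on (\<Omega> \<times> {0..<T})
        (\<lambda>(x, t). vector_derivative (\<lambda>t. \<phi> x * cos (l * t)) (at t within {0..T}))"
      by (elim continuous_on_eq) auto
    show "extends_continuously (\<Omega> \<times> {0<..<T}) (regular_closure \<Omega> \<times> {0<..<T})
          (\<lambda>(x, t). grad (\<lambda>y. \<phi> y * cos (l * t)) x)" if nd: "B \<noteq> Dirichlet"
    proof -
      obtain G where G: "continuous_on (regular_closure \<Omega>) G" "\<And>x. x \<in> \<Omega> \<Longrightarrow> G x = grad \<phi> x"
        using grad_ext[OF nd] by (auto simp: extends_continuously_def)
      have "continuous_on (regular_closure \<Omega> \<times> {0<..<T}) (\<lambda>z. cos (l * snd z) *\<^sub>R G (fst z))"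
        by (intro continuous_intros continuous_on_compose2[OF G(1)]) auto
      then show ?thesis
        unfolding extends_continuously_def
        by (intro exI[of _ "\<lambda>z. cos (l * snd z) *\<^sub>R G (fst z)"])
           (auto simp: G(2) grad_mult_const diff)
    qed
    fix x t assume "x \<in> \<Omega>" "t \<in> {0<..<T}"
    \<comment> \<open>An equality of functions on the whole line, so that it can be rewritten under
      the outer \<open>deriv\<close>.\<close>
    have "deriv (\<lambda>t. \<phi> x * cos (l * t)) = (\<lambda>t. \<phi> x * (- l * sin (l * t)))"
      by (intro ext DERIV_imp_deriv Dw)
    then have "deriv (deriv (\<lambda>t. \<phi> x * cos (l * t))) t = \<phi> x * (- (l\<^sup>2) * cos (l * t))"
      using DERIV_imp_deriv[OF Dw2] by simp
    also have "\<dots> = c\<^sup>2 * laplacian (\<lambda>y. \<phi> y * cos (l * t)) x"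
      using eq[OF \<open>x \<in> \<Omega>\<close>] by (simp add: laplacian_mult_const[OF \<Omega> C2 \<open>x \<in> \<Omega>\<close>] flip: mult.assoc)
    finally show "deriv (deriv (\<lambda>t. \<phi> x * cos (l * t))) t
        = c\<^sup>2 * laplacian (\<lambda>y. \<phi> y * cos (l * t)) x" .
  next
    fix t
    show "satisfies_bc B \<Omega> (\<lambda>y. \<phi> y * cos (l * t))"
      by (rule satisfies_bc_mult_const) (rule bc)
  next
    fix x
    show "((\<lambda>t. \<phi> x * cos (l * t)) has_real_derivative 0) (at 0 within {0..T})"
      using Dw[of x 0] by simp
  qed simp
qed

text \<open>The given \<open>w\<close> shows that the choice in \<open>eigenwave\<close> yields a
  genuine solution; uniqueness then identifies it with \<open>w\<close> at interior times, which
  determine the integral.\<close>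

lemma eigenwave_eqI:
  assumes unique: "wave_solutions_unique c \<Omega> B (final_time \<omega> Np)"
    and w: "wave_solution c \<Omega> B (final_time \<omega> Np) v w" and x: "x \<in> \<Omega>"
  shows "eigenwave c \<Omega> B \<omega> Np v x = 2 / final_time \<omega> Np *
    integral {0..final_time \<omega> Np} (\<lambda>t. (cos (\<omega> * t) - 1 / 4) * w x t)"
proof -
  define T where "T = final_time \<omega> Np"
  define w' where "w' = (SOME w. wave_solution c \<Omega> B T v w)"
  have "wave_solution c \<Omega> B T v w'"
    unfolding w'_def using w by (metis T_def someI)
  then have "w' x t = w x t" if "t \<in> {0<..<T}" for t
    using unique w x that unfolding wave_solutions_unique_def T_def by blast
  then have "integral {0..T} (\<lambda>t. (cos (\<omega> * t) - 1 / 4) * w' x t)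
      = integral {0..T} (\<lambda>t. (cos (\<omega> * t) - 1 / 4) * w x t)"
    \<comment> \<open>Uniqueness is silent about the two end times, a negligible set.\<close>
    by (intro integral_spike[of "{0, T}"]) auto
  then show ?thesis
    by (simp add: eigenwave_def Let_def w'_def flip: T_def)
qed

theorem theorem1:
  fixes \<Omega> :: "'a::euclidean_space set" and B :: "'a bc" and c \<omega> :: real and Np :: nat
    and \<phi> :: "nat \<Rightarrow> 'a \<Rightarrow> real" and lam :: "nat \<Rightarrow> real"
  assumes "bounded_domain \<Omega>" and "c > 0" and "\<omega> > 0" and "Np \<ge> 1"
    and "\<And>j. lam j \<ge> 0"
    and "\<And>j. eigenfunction c \<Omega> B (- ((lam j)\<^sup>2)) (\<phi> j)"
    and "linearly_independent_on \<Omega> \<phi>" and "complete_on \<Omega> \<phi>"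
    and "wave_solutions_unique c \<Omega> B (final_time \<omega> Np)"
  shows "\<forall>j. (\<exists>x\<in>\<Omega>. \<phi> j x \<noteq> 0) \<and>
             (\<exists>w. wave_solution c \<Omega> B (final_time \<omega> Np) (\<phi> j) w) \<and>
             (\<forall>x\<in>\<Omega>. eigenwave c \<Omega> B \<omega> Np (\<phi> j) x = waveholtz_filter \<omega> Np (lam j) * \<phi> j x) \<and>
             waveholtz_filter \<omega> Np (lam j) \<in> {- 1 / 2..1}"
proof (intro allI conjI ballI)
  fix j
  define T where "T = final_time \<omega> Np"
  have "open \<Omega>" "T > 0"
    using assms(1,3,4) by (auto simp: bounded_domain_def T_def final_time_def)
  then have sol: "wave_solution c \<Omega> B (final_time \<omega> Np) (\<phi> j) (\<lambda>x t. \<phi> j x * cos (lam j * t))"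
    using assms(6) unfolding T_def by (rule wave_solution_eigenfunction)
  then show "\<exists>w. wave_solution c \<Omega> B (final_time \<omega> Np) (\<phi> j) w" by blast
  show "\<exists>x\<in>\<Omega>. \<phi> j x \<noteq> 0"
    using assms(6)[of j] by (simp add: eigenfunction_def)
  show "waveholtz_filter \<omega> Np (lam j) \<in> {- 1 / 2..1}"
    using assms(3,4,5) by (rule waveholtz_filter_bounds)
  fix x assume "x \<in> \<Omega>"
  \<comment> \<open>The factor \<open>\<phi> j x\<close> is constant in time; moved to the front, it
    leaves the integral and the filter remains.\<close>
  have "integral {0..T} (\<lambda>t. (cos (\<omega> * t) - 1 / 4) * (\<phi> j x * cos (lam j * t)))
      = integral {0..T} (\<lambda>t. \<phi> j x * ((cos (\<omega> * t) - 1 / 4) * cos (lam j * t)))"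
    by (simp add: mult_ac)
  then show "eigenwave c \<Omega> B \<omega> Np (\<phi> j) x = waveholtz_filter \<omega> Np (lam j) * \<phi> j x"
    using eigenwave_eqI[OF assms(9) sol \<open>x \<in> \<Omega>\<close>]
    by (simp add: waveholtz_filter_def Let_def flip: T_def)
qed

end
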